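(* Let $f$ be a continuous probability density function on $\mathbb{R}_+$, and assume that there exists $\eta>0$ such that $f(x)>0$ for all $x\in\,]0,\eta]$. Then, for every $\zeta>0$, there exists a compact measured metric space $(S,d,\mu)$ such that the distribution $\theta$ arising from $(S,d,\mu)$ has a continuous density $g$ on $\mathbb{R}_+$, where $g\leq(1+\zeta)\cdot f$ pointwise on $\mathbb{R}_+$.
   Context: Notation: $\mathbb{R}_+=[0,\infty[$ and $]0,\eta]$ is the half-open interval excluding $0$. Densities are with respect to Lebesgue measure. A compact measured metric space is a compact metric space $(S,d)$ endowed with a Borel probability measure $\mu$ on $S$. The distribution arising from $(S,d,\mu)$ is the distribution on $\mathbb{R}_+$ of $d(\xi_1,\xi_2)$, where $\xi_1,\xi_2$ are independent random variables with distribution $\mu$. *)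

theory Defs
  imports "HOL-Probability.Probability"
begin

locale compact_measured_metric_space = Metric_space S d + prob_space \<mu>
  for S :: "'a set" and d :: "'a \<Rightarrow> 'a \<Rightarrow> real" and \<mu> :: "'a measure" +
  assumes compact_mtopology: "compact_space mtopology"
    and space_eq: "space \<mu> = S"
    and sets_eq_borel: "sets \<mu> = sigma_sets S {U. openin mtopology U}"

text \<open>
  Measures on \<open>[0, \<infinity>)\<close> live on the subspace itself, so the values of a density at negative
  arguments are irrelevant.
\<close>

abbreviation borel_Rplus :: "real measure" where
  "borel_Rplus \<equiv> restrict_space borel {0..}"

abbreviation lborel_Rplus :: "real measure" where
  "lborel_Rplus \<equiv> restrict_space lborel {0..}"

text \<open>
  Two independent points with law \<open>\<mu>\<close> are realised as the coordinates of the product space.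
\<close>

definition distance_distribution :: "('a \<Rightarrow> 'a \<Rightarrow> real) \<Rightarrow> 'a measure \<Rightarrow> real measure" where
  "distance_distribution d \<mu> = distr (\<mu> \<Otimes>\<^sub>M \<mu>) borel_Rplus (\<lambda>(x, y). d x y)"

text \<open>
  Nonnegativity is explicit because \<^const>\<open>ennreal\<close> truncates negative reals to \<open>0\<close>.
\<close>

definition has_continuous_density :: "real measure \<Rightarrow> (real \<Rightarrow> real) \<Rightarrow> bool" where
  "has_continuous_density \<theta> g \<longleftrightarrow>
     continuous_on {0..} g \<and> (\<forall>x\<ge>0. 0 \<le> g x) \<and> \<theta> = density lborel_Rplus (\<lambda>x. ennreal (g x))"

definition continuous_prob_density :: "(real \<Rightarrow> real) \<Rightarrow> bool" where
  "continuous_prob_density f \<longleftrightarrow>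
     continuous_on {0..} f \<and> (\<forall>x\<ge>0. 0 \<le> f x) \<and> prob_space (density lborel_Rplus (\<lambda>x. ennreal (f x)))"

end

theory Submission
  imports Defs
begin

text \<open>
  The space is a product of a finite ultrametric space and an interval, with the sum of the two
  distances.

  A finitely supported law on \<open>[0, \<infinity>)\<close> with an atom at \<open>0\<close> is always the law of the distance in
  some finite ultrametric space (\<open>finite_ultrametric_with_prescribed_law\<close>): arranging copies of one
  space in clusters adds a new largest distance with any wanted probability, and identical
  clusters leave the conditional law of the smaller distances alone. No triangle inequality
  obstructs such a construction, however spread out the law is.

  To pass to densities, this discrete distance is smeared by an independent small one, living on an
  interval and having a continuous density \<open>\<psi>\<close> on \<open>[0, \<epsilon>]\<close>. Since distance \<open>0\<close> has positive
  probability in the finite space, \<open>\<psi>\<close> itself must be dominated by \<open>f\<close> near \<open>0\<close>, where \<open>f\<close> may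
  decay arbitrarily fast. But it is enough that \<open>\<psi> \<le> C * f\<close> with some constant \<open>C\<close>, because the atom
  at \<open>0\<close> may have mass as small as \<open>\<delta> / C\<close>. Such a \<open>\<psi>\<close> comes from the metric \<open>\<phi> \<bar>s - t\<bar>\<close>, where
  \<open>\<phi>\<close> is the inverse of an antiderivative of an increasing function below \<open>f\<close>
  (\<open>exists_interval_metric_with_dominated_density\<close>, \<open>exists_mono_continuous_minorant\<close>).

  The density of the sum is a mixture of translates of \<open>\<psi>\<close>
  (\<open>exists_product_space_with_mixture_density\<close>). Weighting the translate by \<open>j h\<close> with \<open>h\<close> times
  the minimum of \<open>f\<close> on its support gives a mixture that is below \<open>(1 + \<delta>) * f\<close> and has mass almost
  \<open>1\<close> (\<open>exists_dominated_sum_of_translates\<close>); normalising costs a factor close to \<open>1\<close>.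
\<close>

section \<open>Continuous metrics on compact sets\<close>

text \<open>
  The identity from the compact subspace to the metric space is continuous because the distance
  is, and a continuous bijection from a compact space to a Hausdorff space is a homeomorphism.
\<close>
lemma mtopology_eq_subspace_topology:
  fixes S :: "'a::topological_space set"
  assumes "Metric_space S d" and "compact S"
    and cont: "continuous_on (S \<times> S) (\<lambda>(x, y). d x y)"
  shows "Metric_space.mtopology S d = top_of_set S"
proof -
  interpret Metric_space S d by fact
  have "continuous_map (top_of_set S) mtopology id"
    unfolding continuous_map_to_metric
  proof (intro ballI allI impI)
    fix x and \<epsilon> :: real
    assume "x \<in> topspace (top_of_set S)" and \<epsilon>: "0 < \<epsilon>"
    then have x: "x \<in> S" by simp
    have "continuous_on S (\<lambda>y. (case (x, y) of (x, y) \<Rightarrow> d x y))"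
      by (rule continuous_on_compose2[OF cont]) (use x in \<open>auto intro!: continuous_intros\<close>)
    then have "openin (top_of_set S) (S \<inter> d x -` {..<\<epsilon>})"
      by (intro continuous_openin_preimage_gen) auto
    moreover have "x \<in> S \<inter> d x -` {..<\<epsilon>}" "\<forall>y\<in>S \<inter> d x -` {..<\<epsilon>}. id y \<in> mball (id x) \<epsilon>"
      using x \<epsilon> by auto
    ultimately show "\<exists>U. openin (top_of_set S) U \<and> x \<in> U \<and> (\<forall>y\<in>U. id y \<in> mball (id x) \<epsilon>)"
      by blast
  qed
  then have "homeomorphic_map (top_of_set S) mtopology id"
    using \<open>compact S\<close> Hausdorff_space_mtopology
    by (intro continuous_imp_homeomorphic_map) (auto simp: compact_space_subtopology)
  then show ?thesis by simp
qed

text \<open>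
  The form in which a compact measured metric space is recognised below: topology and Borel sets
  are those of the ambient space, and no ball of \<open>d\<close> has to be examined.
\<close>
lemma compact_measured_metric_spaceI:
  fixes S :: "'a::t2_space set"
  assumes "Metric_space S d" and "compact S"
    and "continuous_on (S \<times> S) (\<lambda>(x, y). d x y)"
    and "prob_space \<mu>" and sets: "sets \<mu> = sets (restrict_space borel S)"
  shows "compact_measured_metric_space S d \<mu>"
proof -
  note top = mtopology_eq_subspace_topology[OF assms(1-3)]
  have "sets (restrict_space borel S) = (\<inter>) S ` sigma_sets UNIV {S. open S}"
    by (simp add: sets_restrict_space sets_borel)
  also have "\<dots> = sigma_sets S ((\<inter>) S ` {S. open S})"
  proof (rule sigma_sets_Int)
    show "S \<in> sigma_sets UNIV {S. open S}"
      using compact_imp_closed[OF \<open>compact S\<close>] by (simp flip: sets_borel)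
  qed simp
  also have "(\<inter>) S ` {S. open S} = {U. openin (top_of_set S) U}"
    by (auto simp: openin_open)
  finally have "sets \<mu> = sigma_sets S {U. openin (Metric_space.mtopology S d) U}"
    by (simp add: sets top)
  moreover have "space \<mu> = S"
    using sets_eq_imp_space_eq[OF sets] by (simp add: space_restrict_space)
  moreover have "compact_space (Metric_space.mtopology S d)"
    unfolding top using \<open>compact S\<close> by (simp add: compact_space_subtopology)
  ultimately show ?thesis
    using assms(1,4)
    by (simp add: compact_measured_metric_space_def compact_measured_metric_space_axioms_def)
qed

text \<open>
  Second countability enters here: it makes the product of the Borel \<open>\<sigma>\<close>-algebras equal to the
  Borel \<open>\<sigma>\<close>-algebra of the product, on which a continuous distance is measurable.
\<close>
lemma measurable_continuous_on_Times:
  fixes S :: "'a::second_countable_topology set" and d :: "'a \<Rightarrow> 'a \<Rightarrow> real"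
  assumes cont: "continuous_on (S \<times> S) (\<lambda>(x, y). d x y)"
    and sets: "sets \<mu> = sets (restrict_space borel S)"
  shows "(\<lambda>(x, y). d x y) \<in> borel_measurable (\<mu> \<Otimes>\<^sub>M \<mu>)"
proof -
  have "space \<mu> = S"
    using sets_eq_imp_space_eq[OF sets] by (simp add: space_restrict_space)
  moreover have [measurable]: "(\<lambda>x. x) \<in> \<mu> \<rightarrow>\<^sub>M borel"
    unfolding measurable_cong_sets[OF sets refl] by (rule measurable_restrict_space1) simp
  ultimately have "(\<lambda>z. (fst z, snd z)) \<in> \<mu> \<Otimes>\<^sub>M \<mu> \<rightarrow>\<^sub>M restrict_space (borel \<Otimes>\<^sub>M borel) (S \<times> S)"
    by (intro measurable_restrict_space2 measurable_Pair) (auto simp: space_pair_measure)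
  then have "(\<lambda>z. z) \<in> \<mu> \<Otimes>\<^sub>M \<mu> \<rightarrow>\<^sub>M restrict_space borel (S \<times> S)"
    by (simp add: borel_prod)
  then show ?thesis
    using borel_measurable_continuous_on_restrict[OF cont] by (rule measurable_compose)
qed

section \<open>Finite ultrametric spaces with a prescribed distance law\<close>

text \<open>
  Two independent draws from \<open>r\<close> agree with probability \<open>\<Sum>i<m. (r i)\<^sup>2\<close>. One heavy point of mass
  \<open>t\<close> beside many equal light ones lets this collision probability run continuously from nearly
  \<open>0\<close> to \<open>1\<close>.
\<close>
lemma exists_weights_sum_squares:
  fixes q :: real
  assumes "0 < q" "q \<le> 1"
  obtains m :: nat and r :: "nat \<Rightarrow> real"
  where "\<And>i. 0 \<le> r i" "(\<Sum>i<m. r i) = 1" "(\<Sum>i<m. (r i)\<^sup>2) = q"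
proof -
  obtain n where n: "inverse (real (Suc n)) < q"
    using reals_Archimedean[OF \<open>0 < q\<close>] by blast
  \<comment> \<open>The collision probability of one point of mass \<open>t\<close> and \<open>Suc n\<close> points sharing \<open>1 - t\<close>;
    at \<open>t = 0\<close> it is \<open>1 / Suc n\<close>, which is below \<open>q\<close>.\<close>
  define F where "F t = t\<^sup>2 + (1 - t)\<^sup>2 / real (Suc n)" for t :: real
  have "\<exists>t. 0 \<le> t \<and> t \<le> 1 \<and> F t = q"
  proof (rule IVT')
    show "continuous_on {0..1} F" unfolding F_def by (intro continuous_intros) auto
  qed (use n assms in \<open>auto simp: F_def inverse_eq_divide\<close>)
  then obtain t where t: "0 \<le> t" "t \<le> 1" "F t = q" by blast
  show thesis
  proof (rule that)
    let ?r = "\<lambda>i. if i = 0 then t else (1 - t) / real (Suc n)"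
    show "0 \<le> ?r i" for i :: nat using t by simp
    show "(\<Sum>i<Suc (Suc n). ?r i) = 1"
      by (subst sum.lessThan_Suc_shift) simp
    show "(\<Sum>i<Suc (Suc n). (?r i)\<^sup>2) = q"
      using t(3) by (subst sum.lessThan_Suc_shift) (simp add: F_def power_divide power2_eq_square)
  qed
qed

text \<open>
  Levels are added from the smallest distance upwards. Given a space with distances up to \<open>x n\<close>,
  several copies of it, with masses \<open>r i\<close>, are placed at mutual distance \<open>x (Suc n)\<close>. All
  copies are alike, so conditionally on the two sampled points lying in the same copy the law of
  their distance is unchanged; the probability of this event is the collision probability of \<open>r\<close>,
  which can be tuned freely. A point mass at \<open>0\<close> is needed to start. The weights are not
  normalised, and \<open>G\<close> is an arbitrary test function, because this form passes through the
  induction directly.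
\<close>
lemma finite_ultrametric_with_prescribed_law:
  fixes w x :: "nat \<Rightarrow> real"
  assumes x: "x 0 = 0" "strict_mono x" and w: "0 < w 0" "\<And>j. 0 \<le> w j"
  shows "\<exists>(A :: nat set) p d. finite A \<and> Metric_space A d \<and> (\<forall>a\<in>A. \<forall>b\<in>A. d a b \<le> x n) \<and>
    (\<forall>a. 0 \<le> p a) \<and> sum p A = 1 \<and>
    (\<forall>G. (\<Sum>j\<le>n. w j) * (\<Sum>a\<in>A. \<Sum>b\<in>A. p a * p b * G (d a b)) = (\<Sum>j\<le>n. w j * G (x j)))"
proof (induction n)
  case 0
  have "Metric_space {0::nat} (\<lambda>a b. 0)" by unfold_locales auto
  then show ?case
    by (intro exI[of _ "{0}"] exI[of _ "\<lambda>_. 1"] exI[of _ "\<lambda>a b. 0"]) (simp add: x)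
next
  case (Suc n)
  from Suc.IH obtain A :: "nat set" and p d
    where IH: "finite A \<and> Metric_space A d \<and> (\<forall>a\<in>A. \<forall>b\<in>A. d a b \<le> x n) \<and> (\<forall>a. 0 \<le> p a) \<and> sum p A = 1 \<and>
      (\<forall>G. (\<Sum>j\<le>n. w j) * (\<Sum>a\<in>A. \<Sum>b\<in>A. p a * p b * G (d a b)) = (\<Sum>j\<le>n. w j * G (x j)))"
    by (elim exE) (rule that)
  then have A: "finite A" "Metric_space A d" "\<And>a b. a \<in> A \<Longrightarrow> b \<in> A \<Longrightarrow> d a b \<le> x n"
    and p: "\<And>a. 0 \<le> p a" "sum p A = 1"
    and law: "\<And>G. (\<Sum>j\<le>n. w j) * (\<Sum>a\<in>A. \<Sum>b\<in>A. p a * p b * G (d a b)) = (\<Sum>j\<le>n. w j * G (x j))"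
    by auto
  interpret A: Metric_space A d by fact
  define W where "W = (\<Sum>j\<le>n. w j)"
  have W: "0 < W"
    unfolding W_def using w by (intro sum_pos2[of _ 0]) auto
  \<comment> \<open>The probability of staying below level \<open>Suc n\<close> is the wanted collision probability.\<close>
  define q where "q = W / (W + w (Suc n))"
  have q: "0 < q" "q \<le> 1" "(W + w (Suc n)) * q = W"
    using W w(2)[of "Suc n"] by (auto simp: q_def field_simps)
  obtain m r where r: "\<And>i::nat. 0 \<le> r i" "(\<Sum>i<m. r i) = 1" "(\<Sum>i<m. (r i)\<^sup>2) = q"
    using exists_weights_sum_squares[OF q(1,2)] by metis
  define B where "B = prod_encode ` (A \<times> {..<m})"
  define f s where "f = fst \<circ> prod_decode" and "s = snd \<circ> prod_decode"
  define D where "D u v = (if s u = s v then d (f u) (f v) else x (Suc n))" for u v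
  define P where "P u = p (f u) * r (s u)" for u
  have fs [simp]: "f (prod_encode (a, i)) = a" "s (prod_encode (a, i)) = i" for a i
    by (simp_all add: f_def s_def)
  have sum_B: "(\<Sum>u\<in>B. H u) = (\<Sum>a\<in>A. \<Sum>i<m. H (prod_encode (a, i)))" for H :: "nat \<Rightarrow> real"
    unfolding B_def by (subst sum.reindex) (auto simp: inj_prod_encode sum.cartesian_product)
  have fB: "f u \<in> A" if "u \<in> B" for u using that by (auto simp: B_def)
  have eq: "u = v" if "f u = f v" "s u = s v" for u v
    using that by (metis comp_apply f_def s_def prod_decode_eq prod_eqI)
  have xn: "0 \<le> x n" "x n < x (Suc n)"
    using x(1) strict_monoD[OF x(2), of n "Suc n"] strict_mono_mono[OF x(2)]
    by (auto simp: mono_def) (metis le0)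
  have dle: "d (f u) (f v) \<le> x n" if "u \<in> B" "v \<in> B" for u v
    using A(3) fB that by blast
  have "Metric_space B D"
  proof
    show "0 \<le> D u v" for u v using xn by (simp add: D_def)
    show "D u v = D v u" for u v by (simp add: D_def A.commute)
    show "D u v = 0 \<longleftrightarrow> u = v" if "u \<in> B" "v \<in> B" for u v
      using xn fB[OF that(1)] fB[OF that(2)] eq[of u v] by (auto simp: D_def)
    show "D u z \<le> D u v + D v z" if "u \<in> B" "v \<in> B" "z \<in> B" for u v z
      using xn A.triangle[of "f u" "f v" "f z"] A.nonneg[of "f u" "f v"] A.nonneg[of "f v" "f z"]
        fB that dle[of u z] by (auto simp: D_def)
  qed
  moreover have "finite B" using A(1) by (simp add: B_def)
  moreover have "\<forall>u\<in>B. \<forall>v\<in>B. D u v \<le> x (Suc n)"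
    using dle xn by (force simp: D_def)
  moreover have "\<forall>u. 0 \<le> P u" using p r by (simp add: P_def)
  moreover have "sum P B = 1"
    by (simp add: sum_B P_def p r(2) flip: sum_distrib_left sum_distrib_right)
  moreover have "(\<Sum>j\<le>Suc n. w j) * (\<Sum>u\<in>B. \<Sum>v\<in>B. P u * P v * G (D u v))
      = (\<Sum>j\<le>Suc n. w j * G (x j))" for G
  proof -
    define E where "E = (\<Sum>a\<in>A. \<Sum>b\<in>A. p a * p b * G (d a b))"
    let ?g = "G (x (Suc n))"
    have inner: "(\<Sum>i<m. \<Sum>j<m. r i * r j * (if i = j then c else e)) = q * c + (1 - q) * e"
      for c e :: real
    proof -
      have "(\<Sum>i<m. \<Sum>j<m. r i * r j * (if i = j then c else e))
          = (\<Sum>i<m. \<Sum>j<m. r i * r j * e + (if i = j then r i * r j * (c - e) else 0))"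
        by (intro sum.cong refl) (auto simp: algebra_simps)
      also have "\<dots> = (\<Sum>i<m. \<Sum>j<m. r i * r j) * e + (\<Sum>i<m. (r i)\<^sup>2) * (c - e)"
        by (simp add: sum.distrib sum_distrib_right power2_eq_square)
      also have "(\<Sum>i<m. \<Sum>j<m. r i * r j) = 1"
        by (simp add: r(2) flip: sum_product)
      finally show ?thesis by (simp add: r(3) algebra_simps)
    qed
    have "(\<Sum>u\<in>B. \<Sum>v\<in>B. P u * P v * G (D u v))
        = (\<Sum>a\<in>A. \<Sum>i<m. \<Sum>b\<in>A. \<Sum>j<m. p a * p b * (r i * r j * (if i = j then G (d a b) else ?g)))"
      unfolding sum_B P_def D_def fs by (intro sum.cong refl) auto
    also have "\<dots> = (\<Sum>a\<in>A. \<Sum>b\<in>A. \<Sum>i<m. \<Sum>j<m. p a * p b * (r i * r j * (if i = j then G (d a b) else ?g)))"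
      by (intro sum.cong refl sum.swap)
    also have "\<dots> = (\<Sum>a\<in>A. \<Sum>b\<in>A. p a * p b * (q * G (d a b) + (1 - q) * ?g))"
      by (simp only: inner sum_distrib_left [symmetric])
    also have "\<dots> = (\<Sum>a\<in>A. \<Sum>b\<in>A. q * (p a * p b * G (d a b)) + (1 - q) * ?g * (p a * p b))"
      by (intro sum.cong refl) (simp add: algebra_simps)
    also have "\<dots> = q * E + (1 - q) * ?g * (\<Sum>a\<in>A. \<Sum>b\<in>A. p a * p b)"
      by (simp only: E_def sum.distrib sum_distrib_left)
    also have "(\<Sum>a\<in>A. \<Sum>b\<in>A. p a * p b) = 1"
      by (simp add: p(2) flip: sum_product)
    finally have "(W + w (Suc n)) * (\<Sum>u\<in>B. \<Sum>v\<in>B. P u * P v * G (D u v))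
        = (W + w (Suc n)) * (q * E + (1 - q) * ?g)" by simp
    also have "\<dots> = ((W + w (Suc n)) * q) * E + ((W + w (Suc n)) - (W + w (Suc n)) * q) * ?g"
      by (simp add: algebra_simps)
    also have "\<dots> = W * E + w (Suc n) * ?g" unfolding q(3) by simp
    also have "W * E = (\<Sum>j\<le>n. w j * G (x j))"
      unfolding W_def E_def by (rule law)
    finally show ?thesis unfolding W_def by simp
  qed
  ultimately show ?case by (intro exI[of _ B] exI[of _ P] exI[of _ D]) simp
qed

section \<open>A metric on the unit interval with a density below a given function\<close>
abbreviation unit_lborel :: "real measure" where
  "unit_lborel \<equiv> restrict_space lborel {0..1}"

lemma prob_space_unit_lborel: "prob_space unit_lborel"
  by (rule prob_spaceI) (simp add: emeasure_restrict_space space_restrict_space)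

text \<open>
  The law of \<open>\<bar>s - t\<bar>\<close> for independent uniform \<open>s\<close>, \<open>t\<close> has the triangular density \<open>2 (1 - x)\<close>.
  Its vanishing at \<open>x = 1\<close> is what later makes a density continuous at the diameter of the
  space; on a circle, where the law is uniform, there would be a jump.
\<close>
lemma nn_integral_abs_difference_uniform:
  fixes G :: "real \<Rightarrow> ennreal"
  assumes [measurable]: "G \<in> borel_measurable borel"
  shows "(\<integral>\<^sup>+s. \<integral>\<^sup>+t. G \<bar>s - t\<bar> \<partial>unit_lborel \<partial>unit_lborel)
    = (\<integral>\<^sup>+x. G x * ennreal (2 * (1 - x)) * indicator {0..1} x \<partial>lborel)"
proof -
  let ?A = "\<lambda>s x. G x * (if 0 \<le> x \<and> x \<le> s \<and> s \<le> 1 then 1 else 0) :: ennreal"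
  let ?B = "\<lambda>s x. G x * (if 0 < x \<and> 0 \<le> s \<and> s \<le> 1 - x then 1 else 0) :: ennreal"
  have "(\<integral>\<^sup>+s. \<integral>\<^sup>+t. G \<bar>s - t\<bar> \<partial>unit_lborel \<partial>unit_lborel)
      = (\<integral>\<^sup>+s. \<integral>\<^sup>+t. G \<bar>s - t\<bar> * indicator {0..1} t * indicator {0..1} s \<partial>lborel \<partial>lborel)"
    by (simp add: nn_integral_restrict_space nn_integral_multc)
  also have "\<dots> = (\<integral>\<^sup>+s. (\<integral>\<^sup>+t. ?A s (s - t) + ?B s (t - s) \<partial>lborel) \<partial>lborel)"
    by (intro nn_integral_cong) (auto split: split_indicator)
  also have "\<dots> = (\<integral>\<^sup>+s. (\<integral>\<^sup>+t. ?A s (s - t) \<partial>lborel) + (\<integral>\<^sup>+t. ?B s (t - s) \<partial>lborel) \<partial>lborel)"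
    by (rule nn_integral_cong, rule nn_integral_add) measurable
  also have "\<dots> = (\<integral>\<^sup>+s. (\<integral>\<^sup>+x. ?A s x \<partial>lborel) + (\<integral>\<^sup>+x. ?B s x \<partial>lborel) \<partial>lborel)"
  proof (rule nn_integral_cong, rule arg_cong2[where f="(+)"])
    fix s :: real
    show "(\<integral>\<^sup>+t. ?A s (s - t) \<partial>lborel) = (\<integral>\<^sup>+x. ?A s x \<partial>lborel)"
      using nn_integral_real_affine[of "?A s" "-1" s] by simp
    show "(\<integral>\<^sup>+t. ?B s (t - s) \<partial>lborel) = (\<integral>\<^sup>+x. ?B s x \<partial>lborel)"
      using nn_integral_real_affine[of "?B s" "1" "-s"] by simp
  qed
  also have "\<dots> = (\<integral>\<^sup>+s. \<integral>\<^sup>+x. ?A s x \<partial>lborel \<partial>lborel) + (\<integral>\<^sup>+s. \<integral>\<^sup>+x. ?B s x \<partial>lborel \<partial>lborel)"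
    by (rule nn_integral_add) measurable
  also have "\<dots> = (\<integral>\<^sup>+x. \<integral>\<^sup>+s. ?A s x \<partial>lborel \<partial>lborel) + (\<integral>\<^sup>+x. \<integral>\<^sup>+s. ?B s x \<partial>lborel \<partial>lborel)"
    by (rule arg_cong2[where f="(+)"]; rule lborel_pair.Fubini') measurable
  also have "\<dots> = (\<integral>\<^sup>+x. (\<integral>\<^sup>+s. ?A s x \<partial>lborel) + (\<integral>\<^sup>+s. ?B s x \<partial>lborel) \<partial>lborel)"
    by (rule nn_integral_add[symmetric]) measurable
  also have "\<dots> = (\<integral>\<^sup>+x. G x * ennreal (2 * (1 - x)) * indicator {0..1} x \<partial>lborel)"
  proof (rule nn_integral_cong_AE)
    have "AE x in lborel. x \<noteq> (0::real)" by (rule AE_lborel_singleton)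
    then show "AE x in lborel. (\<integral>\<^sup>+s. ?A s x \<partial>lborel) + (\<integral>\<^sup>+s. ?B s x \<partial>lborel)
      = G x * ennreal (2 * (1 - x)) * indicator {0..1} x"
    proof eventually_elim
      case (elim x)
      have "ennreal (2 * (1 - x)) = ennreal (1 - x) + ennreal (1 - x)" if "x \<le> 1"
        using that by (subst ennreal_plus[symmetric]) auto
      moreover have "(\<integral>\<^sup>+s. ?A s x \<partial>lborel) = G x * (ennreal (1 - x) * indicator {0..1} x)"
      proof -
        have "(\<integral>\<^sup>+s. ?A s x \<partial>lborel) = (\<integral>\<^sup>+s. (G x * indicator {0..1} x) * indicator {x..1} s \<partial>lborel)"
          by (intro nn_integral_cong) (auto split: split_indicator)
        then show ?thesis
          by (simp add: nn_integral_cmult split: split_indicator)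
      qed
      moreover have "(\<integral>\<^sup>+s. ?B s x \<partial>lborel) = G x * (ennreal (1 - x) * indicator {0..1} x)"
      proof -
        have "(\<integral>\<^sup>+s. ?B s x \<partial>lborel) = (\<integral>\<^sup>+s. (G x * indicator {0..1} x) * indicator {0..1 - x} s \<partial>lborel)"
          using elim by (intro nn_integral_cong) (auto split: split_indicator)
        then show ?thesis
          by (simp add: nn_integral_cmult split: split_indicator)
      qed
      ultimately show ?case
        by (simp add: distrib_left split: split_indicator)
    qed
  qed
  finally show ?thesis .
qed

lemma superadditive_if_derivative_mono:
  fixes h k :: "real \<Rightarrow> real"
  assumes der: "\<And>x. 0 \<le> x \<Longrightarrow> x \<le> \<epsilon> \<Longrightarrow> (h has_real_derivative k x) (at x)"
    and "mono k" and "h 0 = 0" and ab: "0 \<le> a" "0 \<le> b" "a + b \<le> \<epsilon>"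
  shows "h a + h b \<le> h (a + b)"
proof -
  have "h (a + 0) - h 0 \<le> h (a + b) - h b"
  proof (rule DERIV_nonneg_imp_nondecreasing[where f="\<lambda>x. h (a + x) - h x"])
    fix x assume x: "0 \<le> x" "x \<le> b"
    have "((\<lambda>x. h (a + x) - h x) has_real_derivative k (a + x) * (0 + 1) - k x) (at x)"
      using x ab by (intro derivative_intros DERIV_chain2[of h] der) auto
    moreover have "k x \<le> k (a + x)" using \<open>mono k\<close> ab by (simp add: monoD)
    ultimately show "\<exists>y. ((\<lambda>x. h (a + x) - h x) has_real_derivative y) (at x) \<and> 0 \<le> y"
      by (intro exI conjI) auto
  qed (use ab in auto)
  then show ?thesis using \<open>h 0 = 0\<close> by simp
qed

text \<open>
  Let \<open>h\<close> be the antiderivative of \<open>k\<close>, normalised to \<open>h 0 = 0\<close> and \<open>h \<epsilon> = 1\<close>, and \<open>\<phi>\<close> its inverse.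
  As \<open>k\<close> is increasing, \<open>h\<close> is superadditive, so \<open>\<phi>\<close> is subadditive and \<open>\<phi> \<bar>s - t\<bar>\<close> is a metric.
  The substitution \<open>x = h r\<close> turns the triangular law of \<open>\<bar>s - t\<bar>\<close> into the density
  \<open>2 (1 - h r) h' r\<close> on \<open>[0, \<epsilon>]\<close>, which is at most a multiple of \<open>k\<close>. Thus a density at small
  distances can be forced to decay at \<open>0\<close> as fast as desired.
\<close>
lemma exists_interval_metric_with_dominated_density:
  fixes k :: "real \<Rightarrow> real"
  assumes \<epsilon>: "0 < \<epsilon>" and k: "continuous_on UNIV k" "mono k"
    and k0: "\<And>r. r \<le> 0 \<Longrightarrow> k r = 0" and kpos: "\<And>r. 0 < r \<Longrightarrow> 0 < k r"
  obtains \<rho> \<psi> C where "Metric_space {0..1} \<rho>"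
    and "continuous_on ({0..1} \<times> {0..1}) (\<lambda>(s, t). \<rho> s t)"
    and "continuous_on UNIV \<psi>" and "\<And>r. 0 \<le> \<psi> r" and "\<And>r. r \<notin> {0..\<epsilon>} \<Longrightarrow> \<psi> r = 0"
    and "0 < C" and "\<And>r. \<psi> r \<le> C * k r"
    and "\<And>G. G \<in> borel_measurable borel \<Longrightarrow>
      (\<integral>\<^sup>+s. \<integral>\<^sup>+t. G (\<rho> s t) \<partial>unit_lborel \<partial>unit_lborel) = (\<integral>\<^sup>+r. G r * ennreal (\<psi> r) \<partial>lborel)"
proof -
  have knn: "0 \<le> k r" for r using k0[of r] kpos[of r] by (cases "r \<le> 0") auto
  \<comment> \<open>Starting at \<open>-1\<close> makes \<open>0\<close> an interior point and costs nothing, as \<open>k = 0\<close> on \<open>[-1, 0]\<close>.\<close>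
  define H where "H x = integral {-1..x} k" for x
  have derH: "(H has_real_derivative k x) (at x)" if "0 \<le> x" "x \<le> \<epsilon>" for x
  proof -
    have "(H has_real_derivative k x) (at x within {-1..\<epsilon> + 1})"
      unfolding H_def using that
      by (intro integral_has_real_derivative continuous_on_subset[OF k(1)]) auto
    moreover have "at x within {-1..\<epsilon> + 1} = at x"
      using that by (intro at_within_interior) auto
    ultimately show ?thesis by simp
  qed
  have H0: "H 0 = 0"
    unfolding H_def by (rule integral_unique, rule has_integral_is_0) (auto simp: k0)
  have H_less: "H x < H y" if "0 \<le> x" "x < y" "y \<le> \<epsilon>" for x y
  proof (rule DERIV_pos_imp_increasing_open[OF \<open>x < y\<close>])
    show "continuous_on {x..y} H"
      by (intro continuous_at_imp_continuous_on ballI DERIV_isCont[OF derH]) (use that in auto)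
    show "\<exists>d. (H has_real_derivative d) (at u) \<and> 0 < d" if "x < u" "u < y" for u
      using that \<open>0 \<le> x\<close> \<open>y \<le> \<epsilon>\<close> derH[of u] kpos[of u] by auto
  qed
  define c where "c = H \<epsilon>"
  have c: "0 < c" using H_less[of 0 \<epsilon>] \<epsilon> by (simp add: c_def H0)
  define h where "h x = H x / c" for x
  have derh: "(h has_real_derivative k x / c) (at x)" if "0 \<le> x" "x \<le> \<epsilon>" for x
    unfolding h_def using derH[OF that] c by (auto intro!: derivative_eq_intros)
  have h0: "h 0 = 0" and h\<epsilon>: "h \<epsilon> = 1" using c by (auto simp: h_def H0 c_def)
  have h_less: "h x < h y" if "0 \<le> x" "x < y" "y \<le> \<epsilon>" for x y
    using H_less[OF that] c by (simp add: h_def divide_strict_right_mono)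
  have conth: "continuous_on {0..\<epsilon>} h"
    by (intro continuous_at_imp_continuous_on ballI DERIV_isCont[OF derh]) auto
  have injh: "inj_on h {0..\<epsilon>}"
    by (rule linorder_inj_onI) (use h_less in fastforce)+
  have hrange: "h x \<in> {0..1}" if "x \<in> {0..\<epsilon>}" for x
    using h_less[of 0 x] h_less[of x \<epsilon>] that h0 h\<epsilon> by (cases "x = 0"; cases "x = \<epsilon>") auto
  have himg: "h ` {0..\<epsilon>} = {0..1}"
  proof
    show "{0..1} \<subseteq> h ` {0..\<epsilon>}"
    proof
      fix y :: real assume "y \<in> {0..1}"
      then have "\<exists>x\<ge>0. x \<le> \<epsilon> \<and> h x = y"
        by (intro IVT') (use \<epsilon> h0 h\<epsilon> conth in auto)
      then show "y \<in> h ` {0..\<epsilon>}" by force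
    qed
  qed (use hrange in auto)
  \<comment> \<open>Clipping makes \<open>\<phi>\<close> continuous, hence measurable, on the whole line.\<close>
  define \<phi> where "\<phi> y = the_inv_into {0..\<epsilon>} h (max 0 (min 1 y))" for y
  have \<phi>h: "\<phi> (h x) = x" if "x \<in> {0..\<epsilon>}" for x
    using hrange[OF that] the_inv_into_f_f[OF injh that] by (simp add: \<phi>_def)
  have \<phi>: "\<phi> y \<in> {0..\<epsilon>}" "h (\<phi> y) = y" if "y \<in> {0..1}" for y
  proof -
    have "max 0 (min 1 y) = y" using that by simp
    then show "\<phi> y \<in> {0..\<epsilon>}" "h (\<phi> y) = y"
      using the_inv_into_into[OF injh _ subset_refl, of y] f_the_inv_into_f[OF injh, of y] that himg
      by (auto simp: \<phi>_def)
  qed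
  have cont\<phi>: "continuous_on UNIV \<phi>"
  proof -
    have "continuous_on {0..1} (the_inv_into {0..\<epsilon>} h)"
      using continuous_on_inv_into[OF conth _ injh] himg by simp
    then show ?thesis unfolding \<phi>_def
      by (rule continuous_on_compose2) (auto intro!: continuous_intros)
  qed
  have \<phi>0: "\<phi> 0 = 0" using \<phi>h[of 0] \<epsilon> h0 by simp
  have \<phi>_triangle: "\<phi> z \<le> \<phi> x + \<phi> y"
    if "x \<in> {0..1}" "y \<in> {0..1}" "z \<in> {0..1}" "z \<le> x + y" for x y z
  proof (rule ccontr)
    assume "\<not> \<phi> z \<le> \<phi> x + \<phi> y"
    then have less: "\<phi> x + \<phi> y < \<phi> z" by simp
    have "h (\<phi> x) + h (\<phi> y) \<le> h (\<phi> x + \<phi> y)"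
      using \<phi>(1)[OF that(1)] \<phi>(1)[OF that(2)] \<phi>(1)[OF that(3)] less k(2) c h0 derh
      by (intro superadditive_if_derivative_mono[where k="\<lambda>x. k x / c" and \<epsilon>=\<epsilon>])
         (auto simp: mono_def divide_right_mono)
    also have "\<dots> < h (\<phi> z)"
      using \<phi>(1)[OF that(1)] \<phi>(1)[OF that(2)] \<phi>(1)[OF that(3)] less by (intro h_less) auto
    finally show False using that by (simp add: \<phi>(2))
  qed
  define \<rho> where "\<rho> s t = \<phi> \<bar>s - t\<bar>" for s t
  \<comment> \<open>Outside \<open>[0, \<epsilon>]\<close> one of the two factors vanishes: \<open>k r\<close> on the left, \<open>1 - h \<epsilon>\<close> on the right.\<close>
  define \<psi> where "\<psi> r = 2 * (1 - h (max 0 (min \<epsilon> r))) * (k r / c)" for r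
  have hclip: "h (max 0 (min \<epsilon> r)) \<in> {0..1}" for r
    using hrange[of "max 0 (min \<epsilon> r)"] \<epsilon> by auto
  show thesis
  proof
    show "Metric_space {0..1} \<rho>"
    proof
      have "\<phi> y \<ge> 0" for y
        using \<phi>(1)[of "max 0 (min 1 y)"] by (auto simp: \<phi>_def)
      then show "0 \<le> \<rho> s t" for s t by (simp add: \<rho>_def)
      show "\<rho> s t = \<rho> t s" for s t by (simp add: \<rho>_def abs_minus_commute)
      show "\<rho> s t = 0 \<longleftrightarrow> s = t" if "s \<in> {0..1}" "t \<in> {0..1}" for s t
        using \<phi>(2)[of "\<bar>s - t\<bar>"] that h0 \<phi>0 by (auto simp: \<rho>_def)
      show "\<rho> s u \<le> \<rho> s t + \<rho> t u" if "s \<in> {0..1}" "t \<in> {0..1}" "u \<in> {0..1}" for s t u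
        unfolding \<rho>_def using that by (intro \<phi>_triangle) auto
    qed
    show "continuous_on ({0..1} \<times> {0..1}) (\<lambda>(s, t). \<rho> s t)"
      unfolding \<rho>_def case_prod_beta
      by (rule continuous_on_compose2[OF cont\<phi>]) (auto intro!: continuous_intros)
    show "continuous_on UNIV \<psi>"
    proof -
      have "continuous_on UNIV (\<lambda>r. h (max 0 (min \<epsilon> r)))"
        by (rule continuous_on_compose2[OF conth]) (use \<epsilon> in \<open>auto intro!: continuous_intros\<close>)
      then show ?thesis unfolding \<psi>_def
        using k(1) c by (auto intro!: continuous_intros)
    qed
    show "0 \<le> \<psi> r" for r
      using hclip[of r] knn[of r] c by (simp add: \<psi>_def)
    show "\<psi> r = 0" if "r \<notin> {0..\<epsilon>}" for r
      using that \<epsilon> h\<epsilon> by (cases "r \<le> 0") (auto simp: \<psi>_def k0)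
    show "0 < 2 / c" using c by simp
    show "\<psi> r \<le> (2 / c) * k r" for r
      using hclip[of r] knn[of r] c mult_right_mono[of "2 * (1 - h (max 0 (min \<epsilon> r)))" 2 "k r / c"]
      by (simp add: \<psi>_def)
    fix G :: "real \<Rightarrow> ennreal"
    assume [measurable]: "G \<in> borel_measurable borel"
    have [measurable]: "\<phi> \<in> borel_measurable borel"
      using cont\<phi> by (rule borel_measurable_continuous_onI)
    let ?F = "\<lambda>x. G (\<phi> x) * ennreal (2 * (1 - x))"
    have "(\<integral>\<^sup>+s. \<integral>\<^sup>+t. G (\<rho> s t) \<partial>unit_lborel \<partial>unit_lborel)
        = (\<integral>\<^sup>+x. ?F x * indicator {h 0..h \<epsilon>} x \<partial>lborel)"
      unfolding \<rho>_def h0 h\<epsilon> by (rule nn_integral_abs_difference_uniform) measurable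
    also have "\<dots> = (\<integral>\<^sup>+r. ?F (h r) * ennreal (k r / c) * indicator {0..\<epsilon>} r \<partial>lborel)"
      by (rule nn_integral_substitution_aux)
         (use \<epsilon> c k(1) knn derh in \<open>auto intro!: continuous_intros intro: continuous_on_subset\<close>)
    also have "\<dots> = (\<integral>\<^sup>+r. G r * ennreal (\<psi> r) \<partial>lborel)"
    proof (intro nn_integral_cong)
      fix r
      show "?F (h r) * ennreal (k r / c) * indicator {0..\<epsilon>} r = G r * ennreal (\<psi> r)"
      proof (cases "r \<in> {0..\<epsilon>}")
        case True
        then show ?thesis using hrange[OF True] knn[of r] c
          by (simp add: \<phi>h \<psi>_def mult.assoc flip: ennreal_mult)
      next
        case False
        then have "\<psi> r = 0"
          using \<epsilon> h\<epsilon> by (cases "r \<le> 0") (auto simp: \<psi>_def k0)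
        then show ?thesis using False by simp
      qed
    qed
    finally show "(\<integral>\<^sup>+s. \<integral>\<^sup>+t. G (\<rho> s t) \<partial>unit_lborel \<partial>unit_lborel)
      = (\<integral>\<^sup>+r. G r * ennreal (\<psi> r) \<partial>lborel)" .
  qed
qed

section \<open>Adding the continuous metric to a finite one\<close>

text \<open>
  The sum of a metric on \<open>A\<close> and one on \<open>[0, 1]\<close> is a metric on \<open>A \<times> [0, 1]\<close>, and under a product
  measure the two distances are independent; hence the density of their sum is a mixture of
  translates of \<open>\<psi>\<close>. Points \<open>(a, s)\<close> are encoded as the sequences \<open>(a, s, s, s, \<dots>)\<close>.
\<close>
lemma exists_product_space_with_mixture_density:
  fixes A :: "nat set" and p :: "nat \<Rightarrow> real" and \<psi> :: "real \<Rightarrow> real"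
  assumes "finite A" and dA: "Metric_space A dA" and p: "\<And>a. 0 \<le> p a" "sum p A = 1"
    and \<rho>: "Metric_space {0..1} \<rho>" "continuous_on ({0..1} \<times> {0..1}) (\<lambda>(s, t). \<rho> s t)"
    and [measurable]: "\<psi> \<in> borel_measurable borel" and \<psi>: "\<And>r. 0 \<le> \<psi> r"
    and law: "\<And>G. G \<in> borel_measurable borel \<Longrightarrow>
      (\<integral>\<^sup>+s. \<integral>\<^sup>+t. G (\<rho> s t) \<partial>unit_lborel \<partial>unit_lborel) = (\<integral>\<^sup>+r. G r * ennreal (\<psi> r) \<partial>lborel)"
  shows "\<exists>(S :: (nat \<Rightarrow> real) set) d \<mu>. compact_measured_metric_space S d \<mu> \<and>
    distance_distribution d \<mu> = density lborel_Rplus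
      (\<lambda>r. ennreal (\<Sum>a\<in>A. \<Sum>b\<in>A. p a * p b * \<psi> (r - dA a b)))"
proof -
  interpret A: Metric_space A dA by fact
  interpret R: Metric_space "{0..1}" \<rho> by fact
  define e :: "nat \<Rightarrow> real \<Rightarrow> nat \<Rightarrow> real" where "e a s = (\<lambda>n. if n = 0 then real a else s)" for a s
  define i :: "(nat \<Rightarrow> real) \<Rightarrow> nat" where "i \<omega> = nat \<lfloor>\<omega> 0\<rfloor>" for \<omega>
  define S where "S = (\<Union>a\<in>A. e a ` {0..1})"
  define d where "d \<omega> \<omega>' = dA (i \<omega>) (i \<omega>') + \<rho> (\<omega> 1) (\<omega>' 1)" for \<omega> \<omega>'
  have [simp]: "i (e a s) = a" "e a s (Suc 0) = s" "e a s 0 = real a" for a s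
    by (simp_all add: i_def e_def)
  have d_e [simp]: "d (e a s) (e b t) = dA a b + \<rho> s t" for a b s t
    by (simp add: d_def)
  have e_eq [simp]: "e a s = e b t \<longleftrightarrow> a = b \<and> s = t" for a b s t
    by (metis \<open>\<And>s a. i (e a s) = a\<close> \<open>\<And>s a. e a s (Suc 0) = s\<close>)
  have S_cases: "\<exists>a\<in>A. \<exists>s\<in>{0..1}. \<omega> = e a s" if "\<omega> \<in> S" for \<omega>
    using that by (auto simp: S_def)
  have e_in_S: "e a s \<in> S" if "a \<in> A" "s \<in> {0..1}" for a s
    unfolding S_def by (rule UN_I[OF that(1) imageI[OF that(2)]])
  have metric: "Metric_space S d"
  proof
    show "0 \<le> d \<omega> \<omega>'" "d \<omega> \<omega>' = d \<omega>' \<omega>" for \<omega> \<omega>'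
      by (simp_all add: d_def A.commute R.commute)
    show "d \<omega> \<omega>' = 0 \<longleftrightarrow> \<omega> = \<omega>'" if "\<omega> \<in> S" "\<omega>' \<in> S" for \<omega> \<omega>'
      using S_cases[OF that(1)] S_cases[OF that(2)] by (auto simp: add_nonneg_eq_0_iff)
    show "d \<omega> \<omega>'' \<le> d \<omega> \<omega>' + d \<omega>' \<omega>''" if "\<omega> \<in> S" "\<omega>' \<in> S" "\<omega>'' \<in> S" for \<omega> \<omega>' \<omega>''
    proof -
      from S_cases[OF that(1)] S_cases[OF that(2)] S_cases[OF that(3)]
      obtain a s a' s' a'' s'' where "a \<in> A" "a' \<in> A" "a'' \<in> A"
        and "s \<in> {0..1}" "s' \<in> {0..1}" "s'' \<in> {0..1}"
        and "\<omega> = e a s" "\<omega>' = e a' s'" "\<omega>'' = e a'' s''" by blast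
      then show ?thesis
        using A.triangle[of a a' a''] R.triangle[of s s' s''] by simp
    qed
  qed
  have "continuous_on {0..1} (e a)" for a
  proof (rule continuous_on_coordinatewise_then_product)
    show "continuous_on {0..1} (\<lambda>s. e a s n)" for n
      by (cases "n = 0") (simp_all add: e_def)
  qed
  then have compact: "compact S"
    unfolding S_def using \<open>finite A\<close>
    by (intro compact_UN compact_continuous_image) auto
  have cont: "continuous_on (S \<times> S) (\<lambda>(\<omega>, \<omega>'). d \<omega> \<omega>')"
  proof -
    \<comment> \<open>The finite summand of \<open>d\<close> factors through a finite set of reals, on which every function is
      continuous.\<close>
    have pair: "continuous_on (S \<times> S) (\<lambda>z. (fst z n, snd z n))" for n
      by (intro continuous_on_Pair continuous_on_product_then_coordinatewise[where f=fst]
          continuous_on_product_then_coordinatewise[where f=snd] continuous_intros)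
    have finite: "continuous_on (real ` A \<times> real ` A) (\<lambda>(x, y). dA (nat \<lfloor>x\<rfloor>) (nat \<lfloor>y\<rfloor>))"
      using \<open>finite A\<close> by (intro continuous_on_finite) auto
    have "(\<lambda>z. (fst z 0, snd z 0)) ` (S \<times> S) \<subseteq> real ` A \<times> real ` A"
      by (auto dest!: S_cases)
    then have "continuous_on (S \<times> S) (\<lambda>z. dA (i (fst z)) (i (snd z)))"
      using continuous_on_compose2[OF finite pair] by (simp add: i_def)
    moreover have "(\<lambda>z. (fst z 1, snd z 1)) ` (S \<times> S) \<subseteq> {0..1} \<times> {0..1}"
      by (auto dest!: S_cases)
    then have "continuous_on (S \<times> S) (\<lambda>z. \<rho> (fst z 1) (snd z 1))"
      using continuous_on_compose2[OF \<rho>(2) pair] by simp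
    ultimately show ?thesis
      unfolding d_def case_prod_beta by (rule continuous_on_add)
  qed
  define M where "M = point_measure A (\<lambda>a. ennreal (p a))"
  have space_M: "space M = A"
    by (simp add: M_def space_point_measure)
  interpret M: prob_space M
    by (rule prob_spaceI)
       (use p \<open>finite A\<close> in \<open>simp add: M_def space_point_measure emeasure_point_measure_finite sum_ennreal\<close>)
  interpret U: prob_space unit_lborel by (rule prob_space_unit_lborel)
  interpret MU: pair_prob_space M unit_lborel ..
  have e_meas: "(\<lambda>(a, s). e a s) \<in> M \<Otimes>\<^sub>M unit_lborel \<rightarrow>\<^sub>M restrict_space borel S"
  proof (rule measurable_restrict_space2)
    show "(\<lambda>(a, s). e a s) \<in> space (M \<Otimes>\<^sub>M unit_lborel) \<rightarrow> S"
      by (auto simp: space_pair_measure space_M S_def space_restrict_space)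
    have [measurable]: "real \<in> borel_measurable M"
      by (simp add: M_def)
    have [measurable]: "(\<lambda>s. s) \<in> borel_measurable unit_lborel"
      by (rule measurable_restrict_space1) simp
    show "(\<lambda>(a, s). e a s) \<in> M \<Otimes>\<^sub>M unit_lborel \<rightarrow>\<^sub>M borel"
    proof (rule measurable_coordinatewise_then_product)
      fix n :: nat
      have "(\<lambda>z. if n = 0 then real (fst z) else snd z) \<in> borel_measurable (M \<Otimes>\<^sub>M unit_lborel)"
        by (cases "n = 0") simp_all
      then show "(\<lambda>z. (case z of (a, s) \<Rightarrow> e a s) n) \<in> borel_measurable (M \<Otimes>\<^sub>M unit_lborel)"
        by (simp add: e_def case_prod_beta)
    qed
  qed
  define \<mu> where "\<mu> = distr (M \<Otimes>\<^sub>M unit_lborel) (restrict_space borel S) (\<lambda>(a, s). e a s)"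
  have sets_\<mu>: "sets \<mu> = sets (restrict_space borel S)" by (simp add: \<mu>_def)
  interpret \<mu>: prob_space \<mu>
    unfolding \<mu>_def by (rule MU.prob_space_distr) (rule e_meas)
  have int_\<mu>: "(\<integral>\<^sup>+\<omega>. F \<omega> \<partial>\<mu>) = (\<Sum>a\<in>A. ennreal (p a) * (\<integral>\<^sup>+s. F (e a s) \<partial>unit_lborel))"
    if F: "F \<in> borel_measurable \<mu>" for F
  proof -
    have [measurable]: "F \<in> borel_measurable (restrict_space borel S)"
      using F by (simp add: \<mu>_def)
    note e_meas [measurable]
    have [measurable]: "(\<lambda>z. F (case z of (a, s) \<Rightarrow> e a s)) \<in> borel_measurable (M \<Otimes>\<^sub>M unit_lborel)"
      by measurable
    have "(\<integral>\<^sup>+\<omega>. F \<omega> \<partial>\<mu>) = (\<integral>\<^sup>+z. F (case z of (a, s) \<Rightarrow> e a s) \<partial>(M \<Otimes>\<^sub>M unit_lborel))"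
      unfolding \<mu>_def by (rule nn_integral_distr) measurable
    also have "\<dots> = (\<integral>\<^sup>+a. \<integral>\<^sup>+s. F (e a s) \<partial>unit_lborel \<partial>M)"
      by (subst U.nn_integral_fst[symmetric]) simp_all
    finally show ?thesis
      using \<open>finite A\<close> by (simp add: M_def nn_integral_point_measure_finite)
  qed
  define g where "g r = (\<Sum>a\<in>A. \<Sum>b\<in>A. p a * p b * \<psi> (r - dA a b))" for r
  have d_meas: "(\<lambda>(x, y). d x y) \<in> borel_measurable (\<mu> \<Otimes>\<^sub>M \<mu>)"
    by (rule measurable_continuous_on_Times[OF cont sets_\<mu>])
  then have d_meas': "(\<lambda>(x, y). d x y) \<in> \<mu> \<Otimes>\<^sub>M \<mu> \<rightarrow>\<^sub>M borel_Rplus"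
    by (intro measurable_restrict_space2) (auto simp: d_def)
  have int_d: "(\<integral>\<^sup>+z. F (case z of (x, y) \<Rightarrow> d x y) \<partial>(\<mu> \<Otimes>\<^sub>M \<mu>)) = (\<integral>\<^sup>+r. F r * ennreal (g r) \<partial>lborel)"
    if [measurable]: "F \<in> borel_measurable borel" for F
  proof -
    note d_meas [measurable]
    have [measurable]: "(\<lambda>(x, y). F (d x y)) \<in> borel_measurable (\<mu> \<Otimes>\<^sub>M \<mu>)"
      using measurable_compose[OF d_meas that] by (simp add: case_prod_beta)
    have shift: "(\<integral>\<^sup>+s. \<integral>\<^sup>+t. F (dA a b + \<rho> s t) \<partial>unit_lborel \<partial>unit_lborel)
        = (\<integral>\<^sup>+r. F r * ennreal (\<psi> (r - dA a b)) \<partial>lborel)" for a b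
    proof -
      have "(\<integral>\<^sup>+s. \<integral>\<^sup>+t. F (dA a b + \<rho> s t) \<partial>unit_lborel \<partial>unit_lborel)
          = (\<integral>\<^sup>+r. F (dA a b + r) * ennreal (\<psi> r) \<partial>lborel)"
        by (rule law) measurable
      also have "\<dots> = (\<integral>\<^sup>+r. F r * ennreal (\<psi> (r - dA a b)) \<partial>lborel)"
        by (subst nn_integral_real_affine[where c=1 and t="dA a b"]) simp_all
      finally show ?thesis .
    qed
    have \<rho>_meas: "(\<lambda>(s, t). \<rho> s t) \<in> borel_measurable (unit_lborel \<Otimes>\<^sub>M unit_lborel)"
      by (rule measurable_continuous_on_Times[OF \<rho>(2)])
         (rule sets_restrict_space_cong, simp)
    have [measurable]: "(\<lambda>(s, t). F (dA a b + \<rho> s t)) \<in> borel_measurable (unit_lborel \<Otimes>\<^sub>M unit_lborel)" for a b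
      using measurable_compose[OF \<rho>_meas, of "\<lambda>r. F (dA a b + r)" borel] by (simp add: case_prod_beta)
    have "(\<integral>\<^sup>+z. F (case z of (x, y) \<Rightarrow> d x y) \<partial>(\<mu> \<Otimes>\<^sub>M \<mu>)) = (\<integral>\<^sup>+x. \<integral>\<^sup>+y. F (d x y) \<partial>\<mu> \<partial>\<mu>)"
      by (subst \<mu>.nn_integral_fst[symmetric]) (simp_all add: case_prod_beta)
    also have "\<dots> = (\<Sum>a\<in>A. ennreal (p a) * (\<integral>\<^sup>+s. (\<integral>\<^sup>+y. F (d (e a s) y) \<partial>\<mu>) \<partial>unit_lborel))"
      by (rule int_\<mu>) measurable
    also have "\<dots> = (\<Sum>a\<in>A. ennreal (p a) * (\<integral>\<^sup>+s. (\<Sum>b\<in>A. ennreal (p b) *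
        (\<integral>\<^sup>+t. F (dA a b + \<rho> s t) \<partial>unit_lborel)) \<partial>unit_lborel))"
    proof (intro sum.cong refl arg_cong2[where f="(*)"] nn_integral_cong)
      fix a s assume "a \<in> A" "s \<in> space unit_lborel"
      then have "e a s \<in> space \<mu>"
        by (simp add: \<mu>_def space_restrict_space e_in_S)
      then have "(\<lambda>y. F (d (e a s) y)) \<in> borel_measurable \<mu>"
        by measurable
      then show "(\<integral>\<^sup>+y. F (d (e a s) y) \<partial>\<mu>)
          = (\<Sum>b\<in>A. ennreal (p b) * (\<integral>\<^sup>+t. F (dA a b + \<rho> s t) \<partial>unit_lborel))"
        by (subst int_\<mu>) simp_all
    qed
    also have "\<dots> = (\<Sum>a\<in>A. \<Sum>b\<in>A. ennreal (p a * p b) * (\<integral>\<^sup>+r. F r * ennreal (\<psi> (r - dA a b)) \<partial>lborel))"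
      by (simp add: nn_integral_sum nn_integral_cmult shift sum_distrib_left ennreal_mult p mult.assoc)
    also have "\<dots> = (\<integral>\<^sup>+r. (\<Sum>a\<in>A. \<Sum>b\<in>A. ennreal (p a * p b) * (F r * ennreal (\<psi> (r - dA a b)))) \<partial>lborel)"
      by (simp add: nn_integral_sum nn_integral_cmult)
    also have "\<dots> = (\<integral>\<^sup>+r. F r * ennreal (g r) \<partial>lborel)"
      by (intro nn_integral_cong)
         (simp add: g_def sum_distrib_left p \<psi> ennreal_mult sum_nonneg mult_ac flip: sum_ennreal)
    finally show ?thesis .
  qed
  have "distance_distribution d \<mu> = density lborel_Rplus (\<lambda>r. ennreal (g r))"
  proof (rule measure_eqI)
    have sets_eq: "sets lborel_Rplus = sets borel_Rplus"
      by (rule sets_restrict_space_cong) simp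
    then show "sets (distance_distribution d \<mu>) = sets (density lborel_Rplus (\<lambda>r. ennreal (g r)))"
      by (simp add: distance_distribution_def)
    fix B assume "B \<in> sets (distance_distribution d \<mu>)"
    then have B: "B \<in> sets borel_Rplus" by (simp add: distance_distribution_def)
    then have B': "B \<in> sets borel" "B \<subseteq> {0..}"
      by (auto simp: sets_restrict_space_iff)
    have [measurable]: "g \<in> borel_measurable borel" unfolding g_def by measurable
    have "emeasure (distance_distribution d \<mu>) B = (\<integral>\<^sup>+r. indicator B r \<partial>distance_distribution d \<mu>)"
      using B by (simp add: distance_distribution_def)
    also have "\<dots> = (\<integral>\<^sup>+z. indicator B (case z of (x, y) \<Rightarrow> d x y) \<partial>(\<mu> \<Otimes>\<^sub>M \<mu>))"
      unfolding distance_distribution_def using B by (intro nn_integral_distr d_meas') simp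
    also have "\<dots> = (\<integral>\<^sup>+r. indicator B r * ennreal (g r) \<partial>lborel)"
      using B' by (intro int_d) simp
    also have "\<dots> = (\<integral>\<^sup>+r. ennreal (g r) * indicator B r * indicator {0..} r \<partial>lborel)"
      using B' by (intro nn_integral_cong) (auto split: split_indicator)
    also have "\<dots> = (\<integral>\<^sup>+r. ennreal (g r) * indicator B r \<partial>lborel_Rplus)"
      by (simp add: nn_integral_restrict_space)
    also have "\<dots> = emeasure (density lborel_Rplus (\<lambda>r. ennreal (g r))) B"
      using B by (intro emeasure_density[symmetric] measurable_restrict_space1) (simp_all add: sets_eq)
    finally show "emeasure (distance_distribution d \<mu>) B = emeasure (density lborel_Rplus (\<lambda>r. ennreal (g r))) B" .
  qed
  moreover have "compact_measured_metric_space S d \<mu>"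
    by (rule compact_measured_metric_spaceI[OF metric compact cont \<mu>.prob_space_axioms sets_\<mu>])
  ultimately show ?thesis unfolding g_def by blast
qed

section \<open>Dominating a mixture of translates by a given density\<close>

text \<open>
  The infimal convolution \<open>k r = inf {min (f s) s + max 0 (r - s) | s \<in> [0, \<epsilon>]}\<close> is increasing and
  \<open>1\<close>-Lipschitz, as all functions of \<open>r\<close> under the infimum are, and \<open>s = r\<close> shows \<open>k \<le> f\<close>. The
  infimum is attained, so it is positive for \<open>r > 0\<close>: the summands vanish together for no \<open>s\<close>.
  Replacing \<open>f s\<close> by \<open>min (f s) s\<close> makes \<open>k\<close> vanish at \<open>0\<close> even if \<open>f 0 > 0\<close>.
\<close>
lemma exists_mono_continuous_minorant:
  fixes f :: "real \<Rightarrow> real"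
  assumes "0 < \<epsilon>" and f: "continuous_on {0..\<epsilon>} f" "0 \<le> f 0" "\<And>x. x \<in> {0<..\<epsilon>} \<Longrightarrow> 0 < f x"
  obtains k where "continuous_on UNIV k" and "mono k" and "\<And>r. r \<le> 0 \<Longrightarrow> k r = 0"
    and "\<And>r. 0 < r \<Longrightarrow> 0 < k r" and "\<And>r. r \<in> {0..\<epsilon>} \<Longrightarrow> k r \<le> f r"
proof -
  define F where "F r s = min (f s) s + max 0 (r - s)" for r s
  have "\<exists>s\<in>{0..\<epsilon>}. \<forall>t\<in>{0..\<epsilon>}. F r s \<le> F r t" for r
    unfolding F_def using \<open>0 < \<epsilon>\<close> f(1)
    by (intro continuous_attains_inf) (auto intro!: continuous_intros)
  then obtain s where s: "\<And>r. s r \<in> {0..\<epsilon>}" "\<And>r t. t \<in> {0..\<epsilon>} \<Longrightarrow> F r (s r) \<le> F r t"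
    by metis
  have fnn: "0 \<le> f x" if "x \<in> {0..\<epsilon>}" for x
    using f(2) f(3)[of x] that by (cases "x = 0") auto
  define k where "k r = F r (s r)" for r
  have k_le: "k r \<le> F r t" if "t \<in> {0..\<epsilon>}" for r t
    unfolding k_def by (rule s(2)[OF that])
  have nonneg: "0 \<le> k r" for r
    using fnn[OF s(1)[of r]] s(1)[of r] by (simp add: k_def F_def)
  have "k r \<le> k r' + \<bar>r - r'\<bar>" for r r'
    using k_le[OF s(1)[of r'], of r] by (simp add: k_def F_def)
  then have Lipschitz: "\<bar>k r - k r'\<bar> \<le> \<bar>r - r'\<bar>" for r r'
    by (smt (verit))
  show thesis
  proof
    show "continuous_on UNIV k"
      unfolding continuous_on_iff dist_real_def using Lipschitz by (metis le_less_trans)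
    show "mono k"
    proof (rule monoI)
      fix r r' :: real assume "r \<le> r'"
      then show "k r \<le> k r'"
        using k_le[OF s(1)[of r'], of r] by (simp add: k_def F_def)
    qed
    show "k r = 0" if "r \<le> 0" for r
      using k_le[of 0 r] nonneg[of r] that \<open>0 < \<epsilon>\<close> f(2) by (simp add: F_def)
    show "0 < k r" if "0 < r" for r
    proof (cases "s r = 0")
      case True
      then show ?thesis using that f(2) by (simp add: k_def F_def)
    next
      case False
      then have "0 < min (f (s r)) (s r)" using s(1)[of r] f(3)[of "s r"] by auto
      then show ?thesis unfolding k_def F_def by linarith
    qed
    show "k r \<le> f r" if "r \<in> {0..\<epsilon>}" for r
      using k_le[OF that, of r] by (simp add: F_def)
  qed
qed

text \<open>
  Applied to \<open>u\<close> it bounds an upper Riemann sum from below, applied to \<open>- u\<close> a lower one from above.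
\<close>
lemma integral_le_sum_cells:
  fixes u :: "real \<Rightarrow> real"
  assumes "0 \<le> h" and "continuous_on {0..real n * h} u"
    and "\<And>j x. j < n \<Longrightarrow> x \<in> {real j * h..real (Suc j) * h} \<Longrightarrow> u x \<le> c j"
  shows "integral {0..real n * h} u \<le> (\<Sum>j<n. h * c j)"
  using assms
proof (induction n)
  case (Suc n)
  have le: "0 \<le> real n * h" "real n * h \<le> real (Suc n) * h"
    using \<open>0 \<le> h\<close> by (auto simp: mult_right_mono)
  have int: "u integrable_on {0..real (Suc n) * h}"
    using Suc.prems(2) by (rule integrable_continuous_real)
  have "integral {0..real (Suc n) * h} u
      = integral {0..real n * h} u + integral {real n * h..real (Suc n) * h} u"
    using Henstock_Kurzweil_Integration.integral_combine[OF le int] by simp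
  moreover have "integral {0..real n * h} u \<le> (\<Sum>j<n. h * c j)"
    using Suc.prems le by (intro Suc.IH) (auto intro: continuous_on_subset)
  moreover have "integral {real n * h..real (Suc n) * h} u
      \<le> integral {real n * h..real (Suc n) * h} (\<lambda>x. c n)"
  proof (rule integral_le)
    show "u integrable_on {real n * h..real (Suc n) * h}"
      using le by (intro integrable_subinterval_real[OF int]) auto
  qed (use Suc.prems(3)[of n] in auto)
  moreover have "integral {real n * h..real (Suc n) * h} (\<lambda>x. c n) = h * c n"
    using le by (simp add: algebra_simps)
  ultimately show ?case unfolding sum.lessThan_Suc by linarith
qed simp

lemma uniformly_continuous_real_interval:
  fixes u :: "real \<Rightarrow> real"
  assumes "continuous_on {a..b} u" and "0 < e"
  obtains d where "0 < d"
    and "\<And>x y. x \<in> {a..b} \<Longrightarrow> y \<in> {a..b} \<Longrightarrow> \<bar>x - y\<bar> < d \<Longrightarrow> \<bar>u x - u y\<bar> < e"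
  using compact_uniformly_continuous[OF assms(1) compact_Icc] \<open>0 < e\<close>
  unfolding uniformly_continuous_on_def dist_real_def by metis

lemma integral_translate_le:
  fixes \<psi> :: "real \<Rightarrow> real"
  assumes "continuous_on UNIV \<psi>" and "\<And>r. 0 \<le> \<psi> r"
    and \<psi>1: "(\<integral>\<^sup>+r. ennreal (\<psi> r) \<partial>lborel) = 1"
  shows "integral {a..b} (\<lambda>y. \<psi> (r - y)) \<le> 1"
proof -
  have [measurable]: "\<psi> \<in> borel_measurable borel"
    using assms(1) by (rule borel_measurable_continuous_onI)
  have "(\<lambda>y. \<psi> (r - y)) integrable_on {a..b}"
    by (intro integrable_continuous_real continuous_on_compose2[OF assms(1)] continuous_intros) auto
  then have "ennreal (integral {a..b} (\<lambda>y. \<psi> (r - y)))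
      = (\<integral>\<^sup>+y. ennreal (\<psi> (r - y)) * indicator {a..b} y \<partial>lborel)"
    using assms(2) by (intro nn_integral_has_integral_lebesgue'[symmetric]) auto
  also have "\<dots> \<le> (\<integral>\<^sup>+y. ennreal (\<psi> (r - y)) \<partial>lborel)"
    by (intro nn_integral_mono) (auto split: split_indicator)
  also have "\<dots> = 1"
    using nn_integral_real_affine[of "\<lambda>r. ennreal (\<psi> r)" "-1" r] \<psi>1 by simp
  finally show ?thesis by simp
qed

text \<open>
  Take \<open>c j\<close> to be the mesh \<open>h\<close> times the minimum of \<open>f\<close> over the support
  \<open>[j h, j h + \<epsilon>]\<close> of the \<open>j\<close>-th translate. Then the \<open>j\<close>-th summand at \<open>r\<close> is at most
  \<open>f r * (h * \<psi> (r - j h))\<close> whatever the zeros of \<open>f\<close> are, and what remains is a Riemann sum of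
  \<open>\<integral> \<psi> = 1\<close>. Little mass is lost by passing to minima, since \<open>f\<close> oscillates little on intervals
  of length \<open>\<epsilon>\<close>.
\<close>
lemma exists_dominated_sum_of_translates:
  fixes f \<psi> :: "real \<Rightarrow> real"
  assumes f: "continuous_on {0..} f" "\<And>x. 0 \<le> x \<Longrightarrow> 0 \<le> f x"
    and \<psi>: "continuous_on UNIV \<psi>" "\<And>r. 0 \<le> \<psi> r" "\<And>r. r \<notin> {0..\<epsilon>} \<Longrightarrow> \<psi> r = 0"
      "(\<integral>\<^sup>+r. ennreal (\<psi> r) \<partial>lborel) = 1"
    and "0 < \<epsilon>" "0 < R" "0 < \<delta>"
    and osc: "\<And>x y. x \<in> {0..R + \<epsilon>} \<Longrightarrow> y \<in> {0..R + \<epsilon>} \<Longrightarrow> \<bar>x - y\<bar> \<le> \<epsilon> \<Longrightarrow> \<bar>f x - f y\<bar> \<le> \<delta> / R"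
  obtains h n c where "0 < h" and "\<And>j::nat. 0 \<le> c j"
    and "\<And>r. 0 \<le> r \<Longrightarrow> (\<Sum>j\<le>n. c j * \<psi> (r - real j * h)) \<le> (1 + \<delta>) * f r"
    and "integral {0..R} f - \<delta> \<le> (\<Sum>j\<le>n. c j)"
proof -
  have "0 < \<delta> / R" using \<open>0 < R\<close> \<open>0 < \<delta>\<close> by simp
  then obtain d where "0 < d" and d: "\<And>x y. x \<in> {-1..\<epsilon> + 1} \<Longrightarrow> y \<in> {-1..\<epsilon> + 1} \<Longrightarrow>
      \<bar>x - y\<bar> < d \<Longrightarrow> \<bar>\<psi> x - \<psi> y\<bar> < \<delta> / R"
    using uniformly_continuous_real_interval[OF continuous_on_subset[OF \<psi>(1)]] by (metis top_greatest)
  obtain n where n: "R / min (min 1 d) \<epsilon> < real n"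
    using reals_Archimedean2 by blast
  define h where "h = R / real (Suc n)"
  have h: "0 < h" "h < 1" "h < d" "h < \<epsilon>" and Nh: "real (Suc n) * h = R"
  proof -
    let ?m = "min (min 1 d) \<epsilon>"
    have m: "0 < ?m" using \<open>0 < d\<close> \<open>0 < \<epsilon>\<close> by simp
    then have "R < real n * ?m" using n by (simp only: pos_divide_less_eq)
    also have "\<dots> \<le> real (Suc n) * ?m" using m by (intro mult_right_mono) auto
    finally have "h < ?m" by (simp only: h_def pos_divide_less_eq of_nat_0_less_iff zero_less_Suc mult.commute)
    then show "h < 1" "h < d" "h < \<epsilon>" by auto
    show "0 < h" "real (Suc n) * h = R" using \<open>0 < R\<close> by (simp_all add: h_def)
  qed
  have "\<exists>z\<in>{real j * h..real j * h + \<epsilon>}. \<forall>y\<in>{real j * h..real j * h + \<epsilon>}. f z \<le> f y" for j :: nat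
  proof (rule continuous_attains_inf)
    show "continuous_on {real j * h..real j * h + \<epsilon>} f"
      by (rule continuous_on_subset[OF f(1)])
         (use h in \<open>auto intro: order_trans[OF mult_nonneg_nonneg]\<close>)
  qed (use \<open>0 < \<epsilon>\<close> in auto)
  then obtain z where z: "\<And>j. z j \<in> {real j * h..real j * h + \<epsilon>}"
      "\<And>j y. y \<in> {real j * h..real j * h + \<epsilon>} \<Longrightarrow> f (z j) \<le> f y"
    by metis
  have jh: "0 \<le> real j * h" for j using h by simp
  have z_nonneg: "0 \<le> z j" for j using z(1)[of j] jh[of j] by auto
  have jhR: "real (Suc j) * h \<le> R" if "j < Suc n" for j
    unfolding Nh[symmetric] using that h by (intro mult_right_mono) auto
  define c where "c j = h * f (z j)" for j
  show thesis
  proof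
    show "0 < h" by (rule h)
    show "0 \<le> c j" for j using h f(2)[OF z_nonneg[of j]] by (simp add: c_def)
    show "(\<Sum>j\<le>n. c j * \<psi> (r - real j * h)) \<le> (1 + \<delta>) * f r" if "0 \<le> r" for r
    proof -
      have le: "f (z j) * \<psi> (r - real j * h) \<le> f r * \<psi> (r - real j * h)" for j
      proof (cases "r - real j * h \<in> {0..\<epsilon>}")
        case True
        then show ?thesis using z(2)[of r j] \<psi>(2) by (intro mult_right_mono) auto
      next
        case False
        then show ?thesis by (simp add: \<psi>(3))
      qed
      have near: "\<psi> u \<le> \<psi> v + \<delta> / R" if "\<bar>u - v\<bar> \<le> h" for u v
      proof (cases "u \<in> {0..\<epsilon>}")
        case True
        then have "u \<in> {-1..\<epsilon> + 1}" "v \<in> {-1..\<epsilon> + 1}" "\<bar>u - v\<bar> < d"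
          using that h by auto
        then show ?thesis using d[of u v] by linarith
      next
        case False
        then show ?thesis using \<psi>(2)[of v] \<psi>(3)[of u] \<open>0 < \<delta> / R\<close> by simp
      qed
      have cont: "continuous_on {0..R} (\<lambda>y. \<psi> (r - y))"
        by (intro continuous_on_compose2[OF \<psi>(1)] continuous_intros) auto
      have "integral {0..real (Suc n) * h} (\<lambda>y. - \<psi> (r - y) - \<delta> / R)
          \<le> (\<Sum>j<Suc n. h * (- \<psi> (r - real j * h)))"
      proof (rule integral_le_sum_cells)
        fix j y assume "y \<in> {real j * h..real (Suc j) * h}"
        then have "\<psi> (r - real j * h) \<le> \<psi> (r - y) + \<delta> / R"
          by (intro near) (auto simp: algebra_simps)
        then show "- \<psi> (r - y) - \<delta> / R \<le> - \<psi> (r - real j * h)" by simp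
      qed (use h cont Nh in \<open>auto intro!: continuous_intros\<close>)
      moreover have "integral {0..R} (\<lambda>y. - \<psi> (r - y) - \<delta> / R)
          = - integral {0..R} (\<lambda>y. \<psi> (r - y)) - \<delta>"
        using integrable_continuous_real[OF cont] \<open>0 < R\<close>
        by (subst integral_diff) (auto intro!: integrable_neg)
      moreover have "integral {0..R} (\<lambda>y. \<psi> (r - y)) \<le> 1"
        by (rule integral_translate_le[OF \<psi>(1,2,4)])
      ultimately have riemann: "(\<Sum>j<Suc n. h * \<psi> (r - real j * h)) \<le> 1 + \<delta>"
        unfolding Nh by (simp add: sum_negf)
      have "(\<Sum>j<Suc n. c j * \<psi> (r - real j * h)) = (\<Sum>j<Suc n. h * (f (z j) * \<psi> (r - real j * h)))"
        by (simp add: c_def mult.assoc)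
      also have "\<dots> \<le> (\<Sum>j<Suc n. h * (f r * \<psi> (r - real j * h)))"
        using le h by (intro sum_mono mult_left_mono) auto
      also have "\<dots> = f r * (\<Sum>j<Suc n. h * \<psi> (r - real j * h))"
        unfolding sum_distrib_left by (intro sum.cong refl) simp
      also have "\<dots> \<le> f r * (1 + \<delta>)"
        using riemann f(2)[OF that] by (rule mult_left_mono)
      finally show ?thesis by (simp only: lessThan_Suc_atMost mult.commute)
    qed
    show "integral {0..R} f - \<delta> \<le> (\<Sum>j\<le>n. c j)"
    proof -
      have "integral {0..real (Suc n) * h} f \<le> (\<Sum>j<Suc n. h * (f (z j) + \<delta> / R))"
      proof (rule integral_le_sum_cells)
        fix j x assume "j < Suc n" and x: "x \<in> {real j * h..real (Suc j) * h}"
        have "0 \<le> x" using x jh[of j] by simp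
        then have "\<bar>f x - f (z j)\<bar> \<le> \<delta> / R"
          using x \<open>j < Suc n\<close> z(1)[of j] z_nonneg[of j] h jh[of j] jhR[of j]
          by (intro osc) (auto simp: algebra_simps)
        then show "f x \<le> f (z j) + \<delta> / R" by simp
      qed (use h in \<open>auto intro: continuous_on_subset[OF f(1)]\<close>)
      also have "\<dots> = (\<Sum>j<Suc n. c j) + real (Suc n) * (h * (\<delta> / R))"
        by (simp only: c_def distrib_left sum.distrib sum_constant card_lessThan)
      also have "real (Suc n) * (h * (\<delta> / R)) = \<delta>"
        using Nh \<open>0 < R\<close> by (metis mult.assoc nonzero_mult_div_cancel_left less_irrefl times_divide_eq_right)
      finally show ?thesis unfolding Nh by (simp add: lessThan_Suc_atMost)
    qed
  qed
qed

lemma exists_interval_with_almost_full_mass: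
  assumes "continuous_prob_density f" and "0 < \<delta>"
  obtains R where "0 < R" and "1 - \<delta> < integral {0..R} f"
proof -
  let ?D = "density lborel_Rplus (\<lambda>x. ennreal (f x))"
  have f: "continuous_on {0..} f" "\<And>x. 0 \<le> x \<Longrightarrow> 0 \<le> f x" and "prob_space ?D"
    using assms(1) by (auto simp: continuous_prob_density_def)
  interpret D: prob_space ?D by fact
  have sets_eq: "sets lborel_Rplus = sets borel_Rplus"
    by (rule sets_restrict_space_cong) simp
  have [measurable]: "f \<in> borel_measurable lborel_Rplus"
    using borel_measurable_continuous_on_restrict[OF f(1)]
    by (simp add: measurable_cong_sets[OF sets_eq refl])
  have in_sets: "{0..real n} \<in> sets lborel_Rplus" for n
    by (auto simp: sets_restrict_space_iff)
  have "(\<lambda>n. measure ?D {0..real n}) \<longlonglongrightarrow> measure ?D (\<Union>n. {0..real n})"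
    using in_sets by (intro D.finite_Lim_measure_incseq) (auto simp: incseq_def)
  moreover have "(\<Union>n. {0..real n}) = space ?D"
    by (auto simp: space_restrict_space real_arch_simple)
  ultimately have "(\<lambda>n. measure ?D {0..real n}) \<longlonglongrightarrow> 1"
    using D.prob_space by simp
  then have "eventually (\<lambda>n. 1 - \<delta> < measure ?D {0..real n}) sequentially"
    using \<open>0 < \<delta>\<close> by (intro order_tendstoD) auto
  then obtain N where N: "\<And>n. N \<le> n \<Longrightarrow> 1 - \<delta> < measure ?D {0..real n}"
    by (auto simp: eventually_sequentially)
  define n where "n = Suc N"
  have "0 < n" and n: "1 - \<delta> < measure ?D {0..real n}"
    using N[of n] by (simp_all add: n_def)
  have int: "f integrable_on {0..real n}"
    by (intro integrable_continuous_real continuous_on_subset[OF f(1)]) auto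
  then have "ennreal (integral {0..real n} f) = (\<integral>\<^sup>+x. ennreal (f x) * indicator {0..real n} x \<partial>lborel)"
    using f(2) by (intro nn_integral_has_integral_lebesgue'[symmetric]) auto
  also have "\<dots> = (\<integral>\<^sup>+x. ennreal (f x) * indicator {0..real n} x * indicator {0..} x \<partial>lborel)"
    by (intro nn_integral_cong) (auto split: split_indicator)
  also have "\<dots> = emeasure ?D {0..real n}"
    using in_sets by (simp add: emeasure_density nn_integral_restrict_space)
  finally have "emeasure ?D {0..real n} = ennreal (integral {0..real n} f)" ..
  moreover have "0 \<le> integral {0..real n} f"
    using int f(2) by (rule integral_nonneg) simp
  ultimately have "measure ?D {0..real n} = integral {0..real n} f"
    by (simp add: measure_def)
  then show thesis using that[of "real n"] n \<open>0 < n\<close> by simp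
qed

section \<open>The distance distribution below a given density\<close>
(* The carrier type loses no generality: a compact metric space has at most continuum many
   points, so an isometric copy of it lives on a subset of nat => real. The metric d is
   unrelated to any structure of that type. *)
theorem proposition3:
  fixes f :: "real \<Rightarrow> real" and \<eta> \<zeta> :: real
  assumes "continuous_prob_density f"
    and "\<eta> > 0" and "\<forall>x\<in>{0<..\<eta>}. f x > 0"
    and "\<zeta> > 0"
  shows "\<exists>(S :: (nat \<Rightarrow> real) set) d \<mu>. compact_measured_metric_space S d \<mu> \<and>
           (\<exists>g. has_continuous_density (distance_distribution d \<mu>) g \<and>
                (\<forall>x\<ge>0. g x \<le> (1 + \<zeta>) * f x))"
proof -
  have f: "continuous_on {0..} f" "\<And>x. 0 \<le> x \<Longrightarrow> 0 \<le> f x"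
    using assms(1) by (auto simp: continuous_prob_density_def)
  \<comment> \<open>Mass at most \<open>2 * \<delta>\<close> is lost and the bound exceeds \<open>f\<close> by a factor at most \<open>1 + 2 * \<delta>\<close>;
    this \<open>\<delta>\<close> solves \<open>(1 + 2 * \<delta>) / (1 - 2 * \<delta>) = 1 + \<zeta>\<close>.\<close>
  define \<delta> where "\<delta> = \<zeta> / (4 + 2 * \<zeta>)"
  have \<delta>: "0 < \<delta>" "2 * \<delta> < 1" "1 + 2 * \<delta> = (1 + \<zeta>) * (1 - 2 * \<delta>)"
    using \<open>\<zeta> > 0\<close> by (simp_all add: \<delta>_def field_simps)
  obtain R where "0 < R" and R: "1 - \<delta> < integral {0..R} f"
    using exists_interval_with_almost_full_mass[OF assms(1) \<delta>(1)] .
  have "0 < \<delta> / R" using \<delta>(1) \<open>0 < R\<close> by simp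
  then obtain e where "0 < e" and e: "\<And>x y. x \<in> {0..R + \<eta>} \<Longrightarrow> y \<in> {0..R + \<eta>} \<Longrightarrow>
      \<bar>x - y\<bar> < e \<Longrightarrow> \<bar>f x - f y\<bar> < \<delta> / R"
    using uniformly_continuous_real_interval[OF continuous_on_subset[OF f(1)], of 0 "R + \<eta>"]
    by (metis atLeastatMost_subset_iff Icc_subset_Ici_iff order_refl)
  define \<epsilon> where "\<epsilon> = min \<eta> (e / 2)"
  have \<epsilon>: "0 < \<epsilon>" "\<epsilon> \<le> \<eta>" "\<epsilon> < e" using \<open>0 < e\<close> \<open>\<eta> > 0\<close> by (auto simp: \<epsilon>_def)
  obtain k where k: "continuous_on UNIV k" "mono k" "\<And>r. r \<le> 0 \<Longrightarrow> k r = 0"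
      "\<And>r. 0 < r \<Longrightarrow> 0 < k r" and kf: "\<And>r. r \<in> {0..\<epsilon>} \<Longrightarrow> k r \<le> f r"
    using exists_mono_continuous_minorant[OF \<epsilon>(1), of f] f assms(3) \<epsilon>
    by (smt (verit) atLeastAtMost_iff atLeast_iff continuous_on_subset greaterThanAtMost_iff subsetI)
  obtain \<rho> \<psi> C where \<rho>: "Metric_space {0..1} \<rho>" "continuous_on ({0..1} \<times> {0..1}) (\<lambda>(s, t). \<rho> s t)"
    and \<psi>: "continuous_on UNIV \<psi>" "\<And>r. 0 \<le> \<psi> r" "\<And>r. r \<notin> {0..\<epsilon>} \<Longrightarrow> \<psi> r = 0"
    and C: "0 < C" "\<And>r. \<psi> r \<le> C * k r"
    and law: "\<And>G. G \<in> borel_measurable borel \<Longrightarrow>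
      (\<integral>\<^sup>+s. \<integral>\<^sup>+t. G (\<rho> s t) \<partial>unit_lborel \<partial>unit_lborel) = (\<integral>\<^sup>+r. G r * ennreal (\<psi> r) \<partial>lborel)"
    by (rule exists_interval_metric_with_dominated_density[OF \<epsilon>(1) k]) (assumption | rule that)+
  interpret U: prob_space unit_lborel by (rule prob_space_unit_lborel)
  have \<psi>1: "(\<integral>\<^sup>+r. ennreal (\<psi> r) \<partial>lborel) = 1"
    using law[of "\<lambda>_. 1"] U.emeasure_space_1 by simp
  have [measurable]: "\<psi> \<in> borel_measurable borel"
    using \<psi>(1) by (rule borel_measurable_continuous_onI)
  obtain h n c where "0 < h" and c: "\<And>j::nat. 0 \<le> c j"
    and c_le: "\<And>r. 0 \<le> r \<Longrightarrow> (\<Sum>j\<le>n. c j * \<psi> (r - real j * h)) \<le> (1 + \<delta>) * f r"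
    and c_sum: "integral {0..R} f - \<delta> \<le> (\<Sum>j\<le>n. c j)"
  proof (rule exists_dominated_sum_of_translates[OF f \<psi> \<psi>1 \<epsilon>(1) \<open>0 < R\<close> \<delta>(1)])
    show "\<bar>f x - f y\<bar> \<le> \<delta> / R" if "x \<in> {0..R + \<epsilon>}" "y \<in> {0..R + \<epsilon>}" "\<bar>x - y\<bar> \<le> \<epsilon>" for x y
      using e[of x y] that \<epsilon> by auto
  qed (assumption | rule that)+
  \<comment> \<open>The additional atom at \<open>0\<close> keeps the ultrametric construction going even if \<open>c 0 = 0\<close>. It
    contributes at most \<open>(\<delta> / C) * \<psi> \<le> \<delta> * f\<close>, however large \<open>C\<close> is.\<close>
  define w where "w j = c j + (if j = 0 then \<delta> / C else 0)" for j
  define W where "W = (\<Sum>j\<le>n. w j)"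
  have w: "0 < w 0" "0 \<le> w j" for j
    using c[of j] c[of 0] \<delta>(1) C(1) by (auto simp: w_def add_nonneg_pos)
  have sum_w: "(\<Sum>j\<le>n. w j * u j) = (\<Sum>j\<le>n. c j * u j) + \<delta> / C * u 0" for u
  proof -
    have "(\<Sum>j\<le>n. w j * u j) = (\<Sum>j\<le>n. c j * u j + (if j = 0 then \<delta> / C * u 0 else 0))"
      by (intro sum.cong refl) (simp add: w_def algebra_simps)
    then show ?thesis by (simp add: sum.distrib)
  qed
  have W: "1 - 2 * \<delta> < W"
  proof -
    have "0 < \<delta> / C" using \<delta>(1) C(1) by simp
    then show ?thesis using sum_w[of "\<lambda>_. 1"] c_sum R by (simp add: W_def)
  qed
  have "real 0 * h = 0" "strict_mono (\<lambda>j. real j * h)"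
    using \<open>0 < h\<close> by (simp_all add: strict_mono_def)
  from finite_ultrametric_with_prescribed_law[of "\<lambda>j. real j * h" w, OF this w, of n]
  obtain A :: "nat set" and p dA where "finite A \<and> Metric_space A dA \<and>
      (\<forall>a\<in>A. \<forall>b\<in>A. dA a b \<le> real n * h) \<and> (\<forall>a. 0 \<le> p a) \<and> sum p A = 1 \<and>
      (\<forall>G. (\<Sum>j\<le>n. w j) * (\<Sum>a\<in>A. \<Sum>b\<in>A. p a * p b * G (dA a b)) = (\<Sum>j\<le>n. w j * G (real j * h)))"
    by (elim exE) (rule that)
  then have A: "finite A" "Metric_space A dA" and p: "\<And>a. 0 \<le> p a" "sum p A = 1"
    and mixture: "\<And>G. W * (\<Sum>a\<in>A. \<Sum>b\<in>A. p a * p b * G (dA a b)) = (\<Sum>j\<le>n. w j * G (real j * h))"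
    unfolding W_def by auto
  define g where "g r = (\<Sum>a\<in>A. \<Sum>b\<in>A. p a * p b * \<psi> (r - dA a b))" for r
  obtain S :: "(nat \<Rightarrow> real) set" and d \<mu> where space: "compact_measured_metric_space S d \<mu>"
    and density: "distance_distribution d \<mu> = density lborel_Rplus (\<lambda>r. ennreal (g r))"
    using exists_product_space_with_mixture_density[OF A p \<rho> _ \<psi>(2) law] unfolding g_def by auto
  have "has_continuous_density (distance_distribution d \<mu>) g"
    unfolding has_continuous_density_def
  proof (intro conjI density allI impI)
    show "continuous_on {0..} g" unfolding g_def
      by (intro continuous_intros continuous_on_compose2[OF \<psi>(1)]) auto
    show "0 \<le> g r" for r unfolding g_def
      using p(1) \<psi>(2) by (intro sum_nonneg mult_nonneg_nonneg) auto
  qed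
  moreover have "g r \<le> (1 + \<zeta>) * f r" if "0 \<le> r" for r
  proof -
    have "\<psi> r \<le> C * f r"
    proof (cases "r \<in> {0..\<epsilon>}")
      case True
      then show ?thesis using C(2)[of r] kf[of r] C(1) by (smt (verit) mult_left_mono)
    next
      case False
      then show ?thesis using \<psi>(3) f(2)[OF that] C(1) by simp
    qed
    then have "\<delta> / C * \<psi> r \<le> \<delta> / C * (C * f r)"
      using \<delta>(1) C(1) by (intro mult_left_mono) auto
    also have "\<dots> = \<delta> * f r" using C(1) by simp
    finally have atom: "\<delta> / C * \<psi> r \<le> \<delta> * f r" .
    have "W * g r = (\<Sum>j\<le>n. w j * \<psi> (r - real j * h))"
      unfolding g_def by (rule mixture)
    also have "\<dots> = (\<Sum>j\<le>n. c j * \<psi> (r - real j * h)) + \<delta> / C * \<psi> r"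
      using sum_w[of "\<lambda>j. \<psi> (r - real j * h)"] by simp
    also have "\<dots> \<le> (1 + \<delta>) * f r + \<delta> * f r"
      by (intro add_mono c_le atom that)
    also have "\<dots> = (1 + 2 * \<delta>) * f r" by (simp add: algebra_simps)
    also have "\<dots> = (1 - 2 * \<delta>) * ((1 + \<zeta>) * f r)" unfolding \<delta>(3) by simp
    also have "\<dots> \<le> W * ((1 + \<zeta>) * f r)"
      using W f(2)[OF that] \<open>\<zeta> > 0\<close> by (intro mult_right_mono) auto
    finally show ?thesis using W \<delta>(2) by (simp add: mult_le_cancel_left_pos)
  qed
  ultimately show ?thesis using space by blast
qed

end
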